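(* Let $\mathcal{X}$ be a Polish space and let $P(\tau,x,t,\cdot)$, $\tau\le t$ in $\mathbb{R}$, $x\in\mathcal{X}$, be the transition probabilities of an inhomogeneous Markov process on $\mathcal{X}$. Suppose that the transition semigroup $P_{n,n+m}$, $n\in\mathbb{Z}$, $m\in\mathbb{N}$, is Feller. If there exists a Borel probability measure $\mu$ on $\mathcal{X}$ such that for every $n\in\mathbb{Z}$ the set of probability measures $$\Big\{\int_{\mathcal{X}}P(n-s,x,n,\cdot)\,\mu(dx)\Big\}_{s\in\mathbb{N}^{+}}$$ is tight, then there exists an invariant measure family $\{\mu_t\}_{t\in\mathbb{R}}$ for $P$.
   Context: $\mathbb{N}=\{0,1,2,\dots\}$ and $\mathbb{N}^+=\{1,2,\dots\}$. $\mathcal{X}$ carries its Borel $\sigma$-field $\mathcal{B}(\mathcal{X})$. The transition probabilities $P(\tau,x,t,\cdot)$ ($\tau\le t$ real, $x\in\mathcal{X}$) are Borel probability measures on $\mathcal{X}$, measurable in $x$, with $P(t,x,t,\cdot)=\delta_x$, satisfying the Chapman–Kolmogorov equations $P(s,x,t,A)=\int_{\mathcal{X}}P(\tau,y,t,A)P(s,x,\tau,dy)$ for $s\le\tau\le t$. Transition operators on probability measures: $P^{\ast}_{\tau,t}\nu(A)=\int_{\mathcal{X}}P(\tau,x,t,A)\,\nu(dx)$. Transition semigroup on bounded measurable functions: $P_{\tau,t}f(x)=\int_{\mathcal{X}}f(y)P(\tau,x,t,dy)$. Feller: $P_{n,n+m}\phi$ is continuous and bounded whenever $\phi:\mathcal{X}\to\mathbb{R}$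 is continuous and bounded, for all $n\in\mathbb{Z}$, $m\in\mathbb{N}$. Invariant measure family for $P$: a family $\{\mu_t\}_{t\in\mathbb{R}}$ of Borel probability measures on $\mathcal{X}$ such that $P^{\ast}_{s,t}\mu_s=\mu_t$ for every $s\in\mathbb{R}$ and $t\ge s$. *)

theory Defs
  imports "HOL-Probability.Probability"
begin

text \<open>
  \<open>P \<tau> x t\<close> is the measure \<open>P(\<tau>, x, t, \<cdot>)\<close>. It is meaningful only for \<open>\<tau> \<le> t\<close>; nothing is
  required of \<open>P \<tau> x t\<close> when \<open>t < \<tau>\<close>.
\<close>

locale transition_probabilities =
  fixes P :: "real \<Rightarrow> 'a::polish_space \<Rightarrow> real \<Rightarrow> 'a measure"
  assumes sets_P: "\<tau> \<le> t \<Longrightarrow> sets (P \<tau> x t) = sets borel"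
    and prob_space_P: "\<tau> \<le> t \<Longrightarrow> prob_space (P \<tau> x t)"
    and measurable_P:
      "\<tau> \<le> t \<Longrightarrow> A \<in> sets borel \<Longrightarrow> (\<lambda>x. emeasure (P \<tau> x t) A) \<in> borel_measurable borel"
    and P_refl: "P t x t = return borel x"
    and chapman_kolmogorov:
      "s \<le> \<tau> \<Longrightarrow> \<tau> \<le> t \<Longrightarrow> A \<in> sets borel \<Longrightarrow>
        emeasure (P s x t) A = (\<integral>\<^sup>+ y. emeasure (P \<tau> y t) A \<partial>(P s x \<tau>))"

text \<open>
  The monadic bind of the Giry monad is integration of the kernel against \<open>\<nu>\<close>; see
  \<open>emeasure_transition_op\<close> below for the usual formula.
\<close>

definition transition_op ::
  "(real \<Rightarrow> 'a::polish_space \<Rightarrow> real \<Rightarrow> 'a measure) \<Rightarrow> real \<Rightarrow> real \<Rightarrow> 'a measure \<Rightarrow> 'a measure"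
  where "transition_op P \<tau> t \<nu> = Giry_Monad.bind \<nu> (\<lambda>x. P \<tau> x t)"

definition transition_semigroup ::
  "(real \<Rightarrow> 'a::polish_space \<Rightarrow> real \<Rightarrow> 'a measure) \<Rightarrow> real \<Rightarrow> real \<Rightarrow> ('a \<Rightarrow> real) \<Rightarrow> 'a \<Rightarrow> real"
  where "transition_semigroup P \<tau> t f x = (\<integral>y. f y \<partial>(P \<tau> x t))"

text \<open>The Feller property is demanded at integer times only.\<close>

definition feller_integer_times ::
  "(real \<Rightarrow> 'a::polish_space \<Rightarrow> real \<Rightarrow> 'a measure) \<Rightarrow> bool"
  where "feller_integer_times P \<longleftrightarrow>
    (\<forall>(n::int) (m::nat) \<phi>. continuous_on UNIV \<phi> \<and> bounded (range \<phi>) \<longrightarrow>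
      continuous_on UNIV (transition_semigroup P (of_int n) (of_int n + of_nat m) \<phi>) \<and>
      bounded (range (transition_semigroup P (of_int n) (of_int n + of_nat m) \<phi>)))"

text \<open>
  The constant \<open>tight\<close> of \<open>HOL-Probability\<close> covers only sequences of measures on the real line.
\<close>

definition tight_measures :: "'a::topological_space measure set \<Rightarrow> bool"
  where "tight_measures \<M> \<longleftrightarrow>
    (\<forall>\<epsilon>>0. \<exists>K. compact K \<and> (\<forall>\<nu>\<in>\<M>. emeasure \<nu> (UNIV - K) < ennreal \<epsilon>))"

definition invariant_measure_family ::
  "(real \<Rightarrow> 'a::polish_space \<Rightarrow> real \<Rightarrow> 'a measure) \<Rightarrow> (real \<Rightarrow> 'a measure) \<Rightarrow> bool"
  where "invariant_measure_family P \<mu> \<longleftrightarrow>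
    (\<forall>t. sets (\<mu> t) = sets borel \<and> prob_space (\<mu> t)) \<and>
    (\<forall>s t. s \<le> t \<longrightarrow> transition_op P s t (\<mu> s) = \<mu> t)"

context transition_probabilities
begin

lemma measurable_kernel:
  assumes "\<tau> \<le> t"
  shows "(\<lambda>x. P \<tau> x t) \<in> borel \<rightarrow>\<^sub>M prob_algebra borel"
proof (rule measurable_prob_algebraI)
  show "prob_space (P \<tau> x t)" for x
    using assms by (rule prob_space_P)
  show "(\<lambda>x. P \<tau> x t) \<in> borel \<rightarrow>\<^sub>M subprob_algebra borel"
    using assms
    by (intro measurable_subprob_algebra)
      (auto simp: sets_P measurable_P prob_space_P prob_space_imp_subprob_space)
qed

lemma emeasure_transition_op:
  assumes "\<tau> \<le> t" and \<nu>: "sets \<nu> = sets borel" "prob_space \<nu>" and A: "A \<in> sets borel"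
  shows "emeasure (transition_op P \<tau> t \<nu>) A = (\<integral>\<^sup>+ x. emeasure (P \<tau> x t) A \<partial>\<nu>)"
  unfolding transition_op_def
proof (rule emeasure_bind[OF _ _ A])
  show "space \<nu> \<noteq> {}"
    using \<nu>(2) by (rule prob_space.not_empty)
  show "(\<lambda>x. P \<tau> x t) \<in> \<nu> \<rightarrow>\<^sub>M subprob_algebra borel"
    using measurable_prob_algebraD[OF measurable_kernel[OF assms(1)]]
    by (simp cong: measurable_cong_sets add: \<nu>(1))
qed

lemma transition_op_in_prob_algebra:
  assumes "\<tau> \<le> t" and \<nu>: "sets \<nu> = sets borel" "prob_space \<nu>"
  shows "transition_op P \<tau> t \<nu> \<in> space (prob_algebra borel)"
proof -
  show ?thesis
    using \<nu> prob_space_bind'[of \<nu> borel "\<lambda>x. P \<tau> x t" borel]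
      sets_bind'[of \<nu> borel "\<lambda>x. P \<tau> x t" borel] measurable_kernel[OF assms(1)]
    by (simp add: transition_op_def space_prob_algebra)
qed

end

end

theory Submission
  imports Defs
begin

text \<open>
  Start the process with law \<open>\<mu>\<close> at time \<open>-k\<close> and let \<open>\<nu> n k\<close> be its law at the integer time \<open>n\<close>.
  By Tychonoff, some filter finer than \<open>k \<rightarrow> \<infinity>\<close> makes \<open>\<integral> f d(\<nu> n k)\<close> converge to a number \<open>\<Lambda> n f\<close> for all
  \<open>n\<close> and all bounded continuous \<open>f\<close> at once, which replaces Prokhorov's theorem and a diagonal argument.
  Tightness and Dini's theorem make the positive functional \<open>\<Lambda> n\<close> continuous along decreasing null
  sequences, so by the Daniell--Riesz construction it is integration against a probability measure
  \<open>m n\<close>. The Feller property allows passing to the limit in the Chapman--Kolmogorov equations, hence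
  the transition operators carry \<open>m n\<close> to \<open>m (n + k)\<close>. Finally \<open>m \<lfloor>t\<rfloor>\<close> is transported from \<open>\<lfloor>t\<rfloor>\<close> to \<open>t\<close>.
\<close>

subsection \<open>Bounded continuous functions\<close>

definition bounded_continuous :: "('a::topological_space \<Rightarrow> real) \<Rightarrow> bool"
  where "bounded_continuous f \<longleftrightarrow> continuous_on UNIV f \<and> bounded (range f)"

lemma bounded_continuousI:
  fixes f :: "'a::topological_space \<Rightarrow> real"
  assumes "continuous_on UNIV f" "\<And>x. \<bar>f x\<bar> \<le> B"
  shows "bounded_continuous f"
  using assms by (auto simp: bounded_continuous_def bounded_iff)

lemma bounded_continuousE:
  fixes f :: "'a::topological_space \<Rightarrow> real"
  assumes "bounded_continuous f"
  obtains B where "0 \<le> B" "\<And>x. \<bar>f x\<bar> \<le> B"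
proof -
  obtain B where "\<And>x. \<bar>f x\<bar> \<le> B"
    using assms by (auto simp: bounded_continuous_def bounded_iff)
  then show thesis
    by (intro that[of "max 0 B"]) (auto simp: le_max_iff_disj)
qed

lemma bounded_continuous_borel_measurable:
  "bounded_continuous f \<Longrightarrow> f \<in> borel_measurable borel"
  by (simp add: bounded_continuous_def borel_measurable_continuous_onI)

lemma bounded_continuous_const: "bounded_continuous (\<lambda>_. c)"
  by (rule bounded_continuousI[where B="\<bar>c\<bar>"]) auto

lemma bounded_continuous_add:
  assumes "bounded_continuous f" "bounded_continuous g"
  shows "bounded_continuous (\<lambda>x. f x + g x)"
  using assms unfolding bounded_continuous_def by (auto intro: continuous_on_add bounded_plus_comp)

lemma bounded_continuous_cmult:
  assumes "bounded_continuous f"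
  shows "bounded_continuous (\<lambda>x. c * f x)"
proof -
  obtain B where "0 \<le> B" "\<And>x. \<bar>f x\<bar> \<le> B"
    using bounded_continuousE[OF assms] by blast
  then show ?thesis
    using assms unfolding bounded_continuous_def
    by (auto intro!: bounded_continuousI[where B="\<bar>c\<bar> * B", unfolded bounded_continuous_def]
        continuous_intros mult_left_mono simp: abs_mult)
qed

lemma bounded_continuous_diff:
  assumes "bounded_continuous f" "bounded_continuous g"
  shows "bounded_continuous (\<lambda>x. f x - g x)"
  using bounded_continuous_add[OF assms(1) bounded_continuous_cmult[OF assms(2), of "-1"]] by simp

lemma bounded_continuous_sum:
  assumes "\<And>i. i \<in> I \<Longrightarrow> bounded_continuous (f i)"
  shows "bounded_continuous (\<lambda>x. \<Sum>i\<in>I. f i x)"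
  using assms
  by (induction I rule: infinite_finite_induct) (auto intro: bounded_continuous_const bounded_continuous_add)

text \<open>The distance to the complement of an open set is positive exactly on that set, so its
  multiples by \<open>n\<close>, cut off at 1, climb to the indicator.\<close>

lemma indicator_open_approx:
  fixes U :: "'a::metric_space set"
  assumes "open U"
  obtains h :: "nat \<Rightarrow> 'a \<Rightarrow> real"
  where "\<And>n. continuous_on UNIV (h n)" "\<And>n x. 0 \<le> h n x" "\<And>n x. h n x \<le> indicator U x"
    "\<And>x. incseq (\<lambda>n. h n x)" "\<And>x. (\<lambda>n. h n x) \<longlonglongrightarrow> indicator U x"
proof (cases "U = UNIV")
  \<comment> \<open>\<open>infdist\<close> to the empty set is 0 by convention, so the formula used
    in the other case would give only zero functions here.\<close>
  case True
  then show thesis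
    by (intro that[of "\<lambda>_ _. 1"]) auto
next
  case False
  define h :: "nat \<Rightarrow> 'a \<Rightarrow> real" where "h n x = min 1 (real n * infdist x (- U))" for n x
  have zero: "x \<notin> U \<Longrightarrow> infdist x (- U) = 0" for x
    by (simp add: infdist_zero)
  have pos: "x \<in> U \<Longrightarrow> 0 < infdist x (- U)" for x
    using assms False by (intro infdist_pos_not_in_closed) auto
  show thesis
  proof
    show "continuous_on UNIV (h n)" for n
      unfolding h_def by (intro continuous_intros)
    show "0 \<le> h n x" for n x
      by (simp add: h_def infdist_nonneg)
    show "h n x \<le> indicator U x" for n x
      using zero[of x] by (auto simp: h_def indicator_def)
    show "incseq (\<lambda>n. h n x)" for x
      unfolding incseq_def h_def
      by (intro allI impI min.mono order_refl mult_right_mono) (auto simp: infdist_nonneg)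
    show "(\<lambda>n. h n x) \<longlonglongrightarrow> indicator U x" for x
    proof (cases "x \<in> U")
      case True
      obtain N where N: "real N * infdist x (- U) > 1"
        using reals_Archimedean3[OF pos[OF True]] by blast
      have "h n x = 1" if "N \<le> n" for n
      proof -
        have "real N * infdist x (- U) \<le> real n * infdist x (- U)"
          using that by (intro mult_right_mono) (auto simp: infdist_nonneg)
        then show ?thesis
          using N by (simp add: h_def)
      qed
      then show ?thesis
        using True by (intro tendsto_eventually) (auto simp: eventually_sequentially)
    qed (simp add: h_def zero)
  qed
qed

text \<open>Open sets form an intersection-stable generator of the Borel sets, and dominated
  convergence along \<open>indicator_open_approx\<close> recovers the measure of each of them from
  integrals of continuous functions.\<close>

lemma finite_borel_measure_eqI_bounded_continuous:
  fixes M N :: "'a::metric_space measure"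
  assumes M: "finite_measure M" "sets M = sets borel"
    and N: "finite_measure N" "sets N = sets borel"
    and eq: "\<And>f. bounded_continuous f \<Longrightarrow> (\<integral>x. f x \<partial>M) = (\<integral>x. f x \<partial>N)"
  shows "M = N"
proof (rule measure_eqI_generator_eq[where E="{S. open S}" and \<Omega>=UNIV and A="\<lambda>_. UNIV"])
  interpret M: finite_measure M by fact
  interpret N: finite_measure N by fact
  show "Int_stable {S :: 'a set. open S}"
    by (auto simp: Int_stable_def)
  show "sets M = sigma_sets UNIV {S. open S}" "sets N = sigma_sets UNIV {S. open S}"
    using M(2) N(2) by (auto simp: borel_def)
  fix U :: "'a set" assume "U \<in> {S. open S}"
  then have U: "open U" by simp
  then obtain h :: "nat \<Rightarrow> 'a \<Rightarrow> real"
    where h: "\<And>n. continuous_on UNIV (h n)" "\<And>n x. 0 \<le> h n x" "\<And>n x. h n x \<le> indicator U x"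
      "\<And>x. (\<lambda>n. h n x) \<longlonglongrightarrow> indicator U x"
    using indicator_open_approx by metis
  have h1: "\<bar>h n x\<bar> \<le> 1" for n x
    using h(2)[of n x] order_trans[OF h(3)[of n x] indicator_le_1] by simp
  have lim: "(\<lambda>n. \<integral>x. h n x \<partial>K) \<longlonglongrightarrow> measure K U"
    if "finite_measure K" "sets K = sets borel" for K :: "'a measure"
  proof -
    interpret K: finite_measure K by fact
    have meas: "h n \<in> borel_measurable K" for n
      using borel_measurable_continuous_onI[OF h(1)] that(2) by (simp cong: measurable_cong_sets)
    have US: "U \<in> sets K"
      using U that(2) by simp
    have "(\<lambda>n. \<integral>x. h n x \<partial>K) \<longlonglongrightarrow> (\<integral>x. indicator U x \<partial>K)"
      by (rule integral_dominated_convergence[where w="\<lambda>_. 1"]) (use US meas h h1 in auto)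
    then show ?thesis
      using sets_eq_imp_space_eq[OF that(2)] by simp
  qed
  have "(\<integral>x. h n x \<partial>M) = (\<integral>x. h n x \<partial>N)" for n
    using h(1) h1 by (intro eq bounded_continuousI)
  then have "measure M U = measure N U"
    using lim[OF M] lim[OF N] LIMSEQ_unique by auto
  then show "emeasure M U = emeasure N U"
    by (simp add: M.emeasure_eq_measure N.emeasure_eq_measure)
qed (use finite_measure.emeasure_finite[OF M(1)] in auto)

subsection \<open>Daniell functionals\<close>

text \<open>\<open>null_sequence\<close> is Daniell's continuity condition, the source of countable
  subadditivity below. It is stated for continuous functions with values in [0, 1] because these are
  the ones that arise there.\<close>

locale daniell_functional =
  fixes \<Lambda> :: "('a::metric_space \<Rightarrow> real) \<Rightarrow> real"
  assumes add: "bounded_continuous f \<Longrightarrow> bounded_continuous g \<Longrightarrow> \<Lambda> (\<lambda>x. f x + g x) = \<Lambda> f + \<Lambda> g"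
    and cmult: "bounded_continuous f \<Longrightarrow> \<Lambda> (\<lambda>x. c * f x) = c * \<Lambda> f"
    and nonneg: "bounded_continuous f \<Longrightarrow> (\<And>x. 0 \<le> f x) \<Longrightarrow> 0 \<le> \<Lambda> f"
    and one: "\<Lambda> (\<lambda>_. 1) = 1"
    and null_sequence: "(\<And>n. continuous_on UNIV (d n)) \<Longrightarrow> (\<And>n x. 0 \<le> d n x \<and> d n x \<le> 1) \<Longrightarrow>
      (\<And>x. decseq (\<lambda>n. d n x)) \<Longrightarrow> (\<And>x. (\<lambda>n. d n x) \<longlonglongrightarrow> 0) \<Longrightarrow> (\<lambda>n. \<Lambda> (d n)) \<longlonglongrightarrow> 0"
begin

section \<open>Linearity and monotonicity of the functional\<close>

lemma const: "\<Lambda> (\<lambda>_. c) = c"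
  using cmult[OF bounded_continuous_const[of 1], of c] one by simp

lemma diff:
  assumes "bounded_continuous f" "bounded_continuous g"
  shows "\<Lambda> (\<lambda>x. f x - g x) = \<Lambda> f - \<Lambda> g"
  using add[OF assms(1) bounded_continuous_cmult[OF assms(2), of "-1"]] cmult[OF assms(2), of "-1"]
  by simp

lemma mono:
  assumes "bounded_continuous f" "bounded_continuous g" "\<And>x. f x \<le> g x"
  shows "\<Lambda> f \<le> \<Lambda> g"
  using nonneg[OF bounded_continuous_diff[OF assms(2,1)]] diff[OF assms(2,1)] assms(3) by simp

lemma sum:
  assumes "\<And>i. i \<in> I \<Longrightarrow> bounded_continuous (f i)"
  shows "\<Lambda> (\<lambda>x. \<Sum>i\<in>I. f i x) = (\<Sum>i\<in>I. \<Lambda> (f i))"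
  using assms
proof (induction I rule: infinite_finite_induct)
  case (insert i I)
  then show ?case
    using add[of "f i" "\<lambda>x. \<Sum>i\<in>I. f i x"] by (simp add: bounded_continuous_sum)
qed (simp_all add: const)

section \<open>The outer measure induced by the functional\<close>

definition test_functions :: "'a set \<Rightarrow> ('a \<Rightarrow> real) set"
  where "test_functions U = {f. continuous_on UNIV f \<and> (\<forall>x. 0 \<le> f x \<and> f x \<le> indicator U x)}"

text \<open>In the Riesz construction the competing functions have compact support in
  \<open>U\<close>. The space here need not be locally compact, and domination by the indicator
  takes the place of that condition.\<close>

definition content :: "'a set \<Rightarrow> ennreal"
  where "content U = (SUP f\<in>test_functions U. ennreal (\<Lambda> f))"

text \<open>Outer approximation assigns a value to every set, so that Caratheodory's construction
  can run over the whole power set.\<close>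

definition outer :: "'a set \<Rightarrow> ennreal"
  where "outer A = (INF U\<in>{U. open U \<and> A \<subseteq> U}. content U)"

lemma test_functionsD:
  assumes "f \<in> test_functions U"
  shows "continuous_on UNIV f" "bounded_continuous f" "0 \<le> f x" "f x \<le> 1" "x \<notin> U \<Longrightarrow> f x = 0"
    "0 \<le> \<Lambda> f"
proof -
  have f: "continuous_on UNIV f" "\<And>x. 0 \<le> f x" "\<And>x. f x \<le> indicator U x"
    using assms by (auto simp: test_functions_def)
  have le1: "f x \<le> 1" for x
    using order_trans[OF f(3)[of x] indicator_le_1] .
  show "continuous_on UNIV f" "0 \<le> f x" "f x \<le> 1"
    using f le1 by auto
  show "x \<notin> U \<Longrightarrow> f x = 0"
    using f(2)[of x] f(3)[of x] by simp
  show bc: "bounded_continuous f"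
    using f le1 by (intro bounded_continuousI[where B=1]) auto
  show "0 \<le> \<Lambda> f"
    using nonneg[OF bc] f(2) by simp
qed

lemma test_functionsI:
  assumes "continuous_on UNIV f" "\<And>x. 0 \<le> f x" "\<And>x. f x \<le> 1" "\<And>x. x \<notin> U \<Longrightarrow> f x = 0"
  shows "f \<in> test_functions U"
  unfolding test_functions_def
proof (intro CollectI conjI allI)
  fix x show "f x \<le> indicator U x"
    using assms(3)[of x] assms(4)[of x] by (cases "x \<in> U") auto
qed (use assms in auto)

lemma zero_test_function: "(\<lambda>_. 0) \<in> test_functions U"
  by (rule test_functionsI) auto

lemma content_upper: "f \<in> test_functions U \<Longrightarrow> ennreal (\<Lambda> f) \<le> content U"
  unfolding content_def by (rule SUP_upper)

lemma content_mono: "U \<subseteq> V \<Longrightarrow> content U \<le> content V"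
  unfolding content_def
  by (rule SUP_subset_mono) (auto intro!: test_functionsI dest: test_functionsD)

lemma content_UNIV: "content UNIV = 1"
proof (rule antisym)
  show "content UNIV \<le> 1"
    unfolding content_def
  proof (rule SUP_least)
    fix f assume f: "f \<in> test_functions UNIV"
    have "\<Lambda> f \<le> \<Lambda> (\<lambda>_. 1)"
      using test_functionsD(2,4)[OF f] by (intro mono bounded_continuous_const) auto
    then show "ennreal (\<Lambda> f) \<le> 1"
      by (simp add: one)
  qed
  have "(\<lambda>_. 1) \<in> test_functions UNIV"
    by (rule test_functionsI) auto
  then show "1 \<le> content UNIV"
    using content_upper[of "\<lambda>_. 1" UNIV] by (simp add: one)
qed

lemma content_empty: "content {} = 0"
proof -
  have "f = (\<lambda>_. 0)" if "f \<in> test_functions {}" for f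
    using test_functionsD(5)[OF that] by auto
  then have "ennreal (\<Lambda> f) \<le> 0" if "f \<in> test_functions {}" for f
    using that const[of 0] by auto
  then have "content {} \<le> 0"
    unfolding content_def by (rule SUP_least)
  then show ?thesis by simp
qed

text \<open>A test function \<open>f\<close> for the union is almost dominated by finitely many test
  functions for the single sets: its excess over suitable finite sums decreases pointwise to 0, so
  \<open>null_sequence\<close> makes the value of the excess small.\<close>

lemma content_countably_subadditive:
  assumes "\<And>i. open (U i)"
  shows "content (\<Union>i::nat. U i) \<le> (\<Sum>i. content (U i))"
  unfolding content_def[of "\<Union>i. U i"]
proof (rule SUP_least, rule ennreal_le_epsilon)
  fix f :: "'a \<Rightarrow> real" and e :: real
  assume f: "f \<in> test_functions (\<Union>i. U i)" and "0 < e"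
  have "\<exists>h. (\<forall>n. h n \<in> test_functions (U i)) \<and> (\<forall>x. incseq (\<lambda>n. h n x)) \<and>
      (\<forall>x\<in>U i. (\<lambda>n. h n x) \<longlonglongrightarrow> 1)" (is "\<exists>h. ?approx i h") for i
  proof -
    obtain h :: "nat \<Rightarrow> 'a \<Rightarrow> real" where "\<And>n. continuous_on UNIV (h n)" "\<And>n x. 0 \<le> h n x"
      "\<And>n x. h n x \<le> indicator (U i) x" "\<And>x. incseq (\<lambda>n. h n x)"
      and lim: "\<And>x. (\<lambda>n. h n x) \<longlonglongrightarrow> indicator (U i) x"
      by (rule indicator_open_approx[OF assms[of i]]) blast
    moreover have "(\<lambda>n. h n x) \<longlonglongrightarrow> 1" if "x \<in> U i" for x
      using lim[of x] that by simp
    ultimately show ?thesis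
      by (intro exI[of _ h]) (simp add: test_functions_def)
  qed
  then have "\<exists>h. \<forall>i. ?approx i (h i)"
    by (intro choice allI)
  then obtain h where "\<forall>i. ?approx i (h i)" ..
  then have h: "\<And>i n. h i n \<in> test_functions (U i)" "\<And>i x. incseq (\<lambda>n. h i n x)"
      "\<And>i x. x \<in> U i \<Longrightarrow> (\<lambda>n. h i n x) \<longlonglongrightarrow> 1"
    by auto
  \<comment> \<open>Diagonal choice: the \<open>n\<close>-th approximation for each of the first
    \<open>n\<close> sets. More summands and better approximations both increase the sum, so the
    single index \<open>n\<close> suffices.\<close>
  define g where "g n x = (\<Sum>i<n. h i n x)" for n x
  define d where "d n x = max 0 (f x - g n x)" for n x
  have bc_h: "bounded_continuous (h i n)" for i n
    using test_functionsD(2)[OF h(1)] .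
  have bc_g: "bounded_continuous (g n)" for n
    unfolding g_def by (intro bounded_continuous_sum bc_h)
  have g_nonneg: "0 \<le> g n x" for n x
    unfolding g_def by (intro sum_nonneg test_functionsD(3)[OF h(1)])
  have g_mono: "g m x \<le> g n x" if "m \<le> n" for m n x
  proof -
    have "g m x \<le> (\<Sum>i<m. h i n x)"
      unfolding g_def using h(2) that by (intro sum_mono) (auto simp: incseq_def)
    also have "\<dots> \<le> g n x"
      unfolding g_def using that test_functionsD(3)[OF h(1)] by (intro sum_mono2) auto
    finally show ?thesis .
  qed
  have cont_d: "continuous_on UNIV (d n)" for n
    unfolding d_def using test_functionsD(1)[OF f] bc_g[of n]
    by (intro continuous_intros) (auto simp: bounded_continuous_def)
  have d_bounds: "0 \<le> d n x \<and> d n x \<le> 1" for n x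
    using test_functionsD(4)[OF f, of x] g_nonneg[of n x] by (simp add: d_def)
  have "(\<lambda>n. d n x) \<longlonglongrightarrow> 0" for x
  proof (cases "x \<in> (\<Union>i. U i)")
    case True
    then obtain j where j: "x \<in> U j" by blast
    \<comment> \<open>One set \<open>U j\<close> containing \<open>x\<close> is enough:
      \<open>h j n x\<close> is a summand of \<open>g n x\<close> as soon as \<open>j < n\<close>,
      and \<open>f x\<close> is at most 1.\<close>
    have "d n x \<le> 1 - h j n x" if "j < n" for n
    proof -
      have "h j n x \<le> g n x"
        unfolding g_def using that test_functionsD(3)[OF h(1)] by (intro member_le_sum) auto
      then show ?thesis
        using test_functionsD(4)[OF f, of x] test_functionsD(4)[OF h(1), of j n x]
        by (simp add: d_def)
    qed
    then have "\<forall>\<^sub>F n in sequentially. d n x \<le> 1 - h j n x"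
      by (rule eventually_mono[OF eventually_gt_at_top[of j]])
    moreover have "(\<lambda>n. 1 - h j n x) \<longlonglongrightarrow> 0"
      using tendsto_diff[OF tendsto_const h(3)[OF j], of 1] by simp
    ultimately show ?thesis
      using d_bounds by (intro tendsto_sandwich[of "\<lambda>_. 0" "\<lambda>n. d n x" _ "\<lambda>n. 1 - h j n x"]) auto
  next
    case False
    then have "d n x = 0" for n
      using test_functionsD(5)[OF f False] g_nonneg[of n x] by (simp add: d_def)
    then show ?thesis by simp
  qed
  moreover have "decseq (\<lambda>n. d n x)" for x
    unfolding decseq_def d_def by (intro allI impI max.mono order_refl diff_left_mono g_mono)
  ultimately have "(\<lambda>n. \<Lambda> (d n)) \<longlonglongrightarrow> 0"
    using cont_d d_bounds by (intro null_sequence) auto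
  then have "\<forall>\<^sub>F n in sequentially. \<Lambda> (d n) < e"
    using \<open>0 < e\<close> by (rule order_tendstoD(2))
  then obtain n where n: "\<Lambda> (d n) < e"
    unfolding eventually_sequentially by blast
  have bc_d: "bounded_continuous (d n)"
    using d_bounds by (intro bounded_continuousI[where B=1] cont_d) simp
  have "\<Lambda> f \<le> \<Lambda> (\<lambda>x. g n x + d n x)"
    by (intro mono test_functionsD(2)[OF f] bounded_continuous_add bc_g bc_d) (simp add: d_def)
  also have "\<dots> = (\<Sum>i<n. \<Lambda> (h i n)) + \<Lambda> (d n)"
    using add[OF bc_g[of n] bc_d] sum[of "{..<n}" "\<lambda>i. h i n"] bc_h unfolding g_def by simp
  also have "\<dots> \<le> (\<Sum>i<n. \<Lambda> (h i n)) + e"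
    using n by simp
  finally have "ennreal (\<Lambda> f) \<le> ennreal ((\<Sum>i<n. \<Lambda> (h i n)) + e)"
    by (rule ennreal_leI)
  also have "\<dots> = (\<Sum>i<n. ennreal (\<Lambda> (h i n))) + ennreal e"
    using test_functionsD(6)[OF h(1)] \<open>0 < e\<close> by (simp add: sum_nonneg)
  also have "\<dots> \<le> (\<Sum>i<n. content (U i)) + ennreal e"
    by (intro add_mono sum_mono content_upper h(1) order_refl)
  also have "\<dots> \<le> (\<Sum>i. content (U i)) + ennreal e"
    by (intro add_mono sum_le_suminf order_refl) auto
  finally show "ennreal (\<Lambda> f) \<le> (\<Sum>i. content (U i)) + ennreal e" .
qed

lemma outer_lower: "open U \<Longrightarrow> A \<subseteq> U \<Longrightarrow> outer A \<le> content U"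
  unfolding outer_def by (rule INF_lower) auto

lemma outer_mono: "A \<subseteq> B \<Longrightarrow> outer A \<le> outer B"
  unfolding outer_def by (rule INF_superset_mono) auto

lemma outer_open: "open U \<Longrightarrow> outer U = content U"
  by (rule antisym[OF outer_lower]) (auto simp: outer_def intro!: INF_greatest content_mono)

text \<open>Cover each \<open>A i\<close> by an open set that wastes at most
  \<open>e * (1 / 2) ^ Suc i\<close>; these errors add up to \<open>e\<close>, and countable
  subadditivity is known for open sets.\<close>

lemma outer_countably_subadditive: "outer (\<Union>i::nat. A i) \<le> (\<Sum>i. outer (A i))"
proof (rule ennreal_le_epsilon)
  fix e :: real
  assume fin: "(\<Sum>i. outer (A i)) < top" and "0 < e"
  have "\<exists>U. open U \<and> A i \<subseteq> U \<and> content U \<le> outer (A i) + ennreal (e * (1 / 2) ^ Suc i)" for i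
  proof -
    have "outer (A i) < top"
      using ennreal_suminf_lessD[OF fin] .
    \<comment> \<open>\<open>ennreal_le_epsilon\<close> allows the total to be taken as finite. Only
      for finite \<open>outer (A i)\<close> does adding a positive number increase it strictly, as
      \<open>INF_less_iff\<close> requires.\<close>
    then have "outer (A i) < outer (A i) + ennreal (e * (1 / 2) ^ Suc i)"
      using \<open>0 < e\<close> by (simp add: ennreal_add_left_cancel_less less_top)
    then show ?thesis
      unfolding outer_def[of "A i"] INF_less_iff by (auto intro: less_imp_le)
  qed
  then obtain U where U: "\<And>i. open (U i)" "\<And>i. A i \<subseteq> U i"
    "\<And>i. content (U i) \<le> outer (A i) + ennreal (e * (1 / 2) ^ Suc i)"
    by metis
  have "outer (\<Union>i. A i) \<le> content (\<Union>i. U i)"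
    using U by (intro outer_lower) auto
  also have "\<dots> \<le> (\<Sum>i. content (U i))"
    by (rule content_countably_subadditive[OF U(1)])
  also have "\<dots> \<le> (\<Sum>i. outer (A i) + ennreal (e * (1 / 2) ^ Suc i))"
    by (intro suminf_le U(3)) auto
  also have "\<dots> = (\<Sum>i. outer (A i)) + (\<Sum>i. ennreal (e * (1 / 2) ^ Suc i))"
    by (subst suminf_add[symmetric]) auto
  also have "(\<Sum>i. ennreal (e * (1 / 2) ^ Suc i)) = ennreal e"
    using \<open>0 < e\<close> sums_mult[OF power_half_series, of e] by (intro suminf_ennreal_eq) auto
  finally show "outer (\<Union>i. A i) \<le> (\<Sum>i. outer (A i)) + ennreal e" .
qed

text \<open>The substantial half of Caratheodory's criterion for open sets. It suffices to bound by
  \<open>content V\<close> for open \<open>V\<close> containing \<open>A\<close>; there a test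
  function for \<open>V \<inter> U\<close> and one for a neighbourhood of \<open>V - U\<close> have
  to be added without exceeding 1.\<close>

lemma outer_open_split:
  assumes "open U"
  shows "outer (A \<inter> U) + outer (A - U) \<le> outer A"
  unfolding outer_def[of A]
proof (rule INF_greatest)
  fix V assume "V \<in> {V. open V \<and> A \<subseteq> V}"
  then have V: "open V" "A \<subseteq> V" by auto
  have "ennreal (\<Lambda> f) + outer (V - U) \<le> content V" if f: "f \<in> test_functions (V \<inter> U)" for f
  proof (rule ennreal_le_epsilon)
    fix e :: real assume "0 < e"
    \<comment> \<open>As \<open>f\<close> vanishes on \<open>V - U\<close>, the open set where it
      stays below \<open>e\<close> covers \<open>V - U\<close>. Lowering \<open>f\<close> by
      \<open>e\<close> and cutting at 0 makes it vanish on \<open>W\<close>, where \<open>g\<close>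
      lives, and costs at most \<open>e\<close> in the value of the functional.\<close>
    define W where "W = V \<inter> {x. f x < e}"
    have "open W"
      unfolding W_def using V(1) test_functionsD(1)[OF f]
      by (intro open_Int open_Collect_less continuous_on_const) auto
    moreover have "V - U \<subseteq> W"
      using test_functionsD(5)[OF f] \<open>0 < e\<close> by (auto simp: W_def)
    ultimately have "ennreal (\<Lambda> f) + outer (V - U) \<le> ennreal (\<Lambda> f) + content W"
      by (intro add_mono outer_lower order_refl)
    \<comment> \<open>Moving the supremum across the sum requires a nonempty index set; the zero
      function witnesses this here and again at the end.\<close>
    also have "\<dots> = (SUP g\<in>test_functions W. ennreal (\<Lambda> f) + ennreal (\<Lambda> g))"
      unfolding content_def using zero_test_function by (subst ennreal_SUP_add_right) auto
    also have "\<dots> \<le> content V + ennreal e"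
    proof (rule SUP_least)
      fix g assume g: "g \<in> test_functions W"
      define f' where "f' x = max 0 (f x - e)" for x
      have fg: "(\<lambda>x. f' x + g x) \<in> test_functions V"
      proof (rule test_functionsI)
        show "continuous_on UNIV (\<lambda>x. f' x + g x)"
          unfolding f'_def using test_functionsD(1)[OF f] test_functionsD(1)[OF g]
          by (intro continuous_intros)
        show "0 \<le> f' x + g x" for x
          using test_functionsD(3)[OF g, of x] by (simp add: f'_def)
        show "f' x + g x \<le> 1" for x
          using test_functionsD(4)[OF f, of x] test_functionsD(4,5)[OF g, of x] \<open>0 < e\<close>
          by (cases "x \<in> W") (auto simp: f'_def W_def)
        show "f' x + g x = 0" if "x \<notin> V" for x
          using that test_functionsD(5)[OF f, of x] test_functionsD(5)[OF g, of x] \<open>0 < e\<close>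
          by (auto simp: f'_def W_def)
      qed
      have bc: "bounded_continuous (\<lambda>x. f' x + g x)"
        by (rule test_functionsD(2)[OF fg])
      have "\<Lambda> f + \<Lambda> g = \<Lambda> (\<lambda>x. f x + g x)"
        using add[OF test_functionsD(2)[OF f] test_functionsD(2)[OF g]] by simp
      also have "\<dots> \<le> \<Lambda> (\<lambda>x. (f' x + g x) + e)"
        by (intro mono bounded_continuous_add bounded_continuous_const bc
            test_functionsD(2)[OF f] test_functionsD(2)[OF g]) (simp add: f'_def)
      also have "\<dots> = \<Lambda> (\<lambda>x. f' x + g x) + e"
        using add[OF bc bounded_continuous_const, of e] by (simp add: const)
      finally have "ennreal (\<Lambda> f + \<Lambda> g) \<le> ennreal (\<Lambda> (\<lambda>x. f' x + g x) + e)"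
        by (rule ennreal_leI)
      then have "ennreal (\<Lambda> f) + ennreal (\<Lambda> g) \<le> ennreal (\<Lambda> (\<lambda>x. f' x + g x)) + ennreal e"
        using test_functionsD(6)[OF f] test_functionsD(6)[OF g] test_functionsD(6)[OF fg] \<open>0 < e\<close>
        by simp
      also have "\<dots> \<le> content V + ennreal e"
        by (intro add_mono content_upper fg order_refl)
      finally show "ennreal (\<Lambda> f) + ennreal (\<Lambda> g) \<le> content V + ennreal e" .
    qed
    finally show "ennreal (\<Lambda> f) + outer (V - U) \<le> content V + ennreal e" .
  qed
  then have "(SUP f\<in>test_functions (V \<inter> U). ennreal (\<Lambda> f) + outer (V - U)) \<le> content V"
    by (rule SUP_least)
  then have "content (V \<inter> U) + outer (V - U) \<le> content V"
    unfolding content_def[of "V \<inter> U"] using zero_test_function by (subst (asm) ennreal_SUP_add_left) auto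
  moreover have "outer (A \<inter> U) \<le> content (V \<inter> U)"
    using V assms by (intro outer_lower) auto
  moreover have "outer (A - U) \<le> outer (V - U)"
    using V by (intro outer_mono) auto
  ultimately show "outer (A \<inter> U) + outer (A - U) \<le> content V"
    using add_mono order_trans by blast
qed

text \<open>Caratheodory: \<open>outer\<close> is countably additive on the sigma-algebra of its
  measurable sets. \<open>outer_open_split\<close> together with subadditivity puts every open set
  there, hence every Borel set.\<close>

lemma measure_space_outer: "measure_space UNIV (sets borel) outer"
proof -
  have empty: "outer {} = 0"
    by (simp add: outer_open content_empty)
  have oms: "outer_measure_space (Pow UNIV) outer"
    unfolding outer_measure_space_def positive_def increasing_def countably_subadditive_def
    using empty outer_mono outer_countably_subadditive by auto
  interpret sigma_algebra UNIV "Pow UNIV :: 'a set set"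
    by (rule sigma_algebra_Pow)
  let ?L = "lambda_system UNIV (Pow UNIV) outer"
  have ms: "measure_space UNIV ?L outer"
    by (rule caratheodory_lemma[OF oms])
  then interpret L: sigma_algebra UNIV ?L
    by (simp add: measure_space_def)
  have subadd: "subadditive (Pow UNIV) outer"
    using oms by (intro countably_subadditive_subadditive) (auto simp: outer_measure_space_def)
  have "U \<in> ?L" if "open U" for U :: "'a set"
  proof -
    have "outer (U \<inter> A) + outer (- U \<inter> A) = outer A" for A
    proof (rule antisym)
      show "outer (U \<inter> A) + outer (- U \<inter> A) \<le> outer A"
        using outer_open_split[OF that, of A] by (simp add: Int_commute Diff_eq)
      have "outer ((U \<inter> A) \<union> (- U \<inter> A)) \<le> outer (U \<inter> A) + outer (- U \<inter> A)"
        using subadd by (intro subadditiveD) auto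
      moreover have "(U \<inter> A) \<union> (- U \<inter> A) = A" by blast
      ultimately show "outer A \<le> outer (U \<inter> A) + outer (- U \<inter> A)" by simp
    qed
    then show ?thesis
      by (simp add: lambda_system_def Compl_eq_Diff_UNIV)
  qed
  then have "sets borel \<subseteq> ?L"
    unfolding borel_def using L.sigma_sets_subset[of "Collect open"] by auto
  then show ?thesis
    using measure_down[OF ms] sets.sigma_algebra_axioms[of "borel :: 'a measure"] by simp
qed

section \<open>Representation of the functional as an integral\<close>

definition representing_measure :: "'a measure"
  where "representing_measure = measure_of UNIV (sets borel) outer"

lemma sets_representing_measure: "sets representing_measure = sets borel"
  unfolding representing_measure_def
  by (subst sets_measure_of) (auto simp: sets.sigma_sets_eq[of borel, simplified])

lemma emeasure_representing_measure:
  "A \<in> sets borel \<Longrightarrow> emeasure representing_measure A = outer A"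
  unfolding representing_measure_def using measure_space_outer
  by (subst emeasure_measure_of_conv) (auto simp: sets.sigma_sets_eq[of borel, simplified])

lemma prob_space_representing_measure: "prob_space representing_measure"
proof (rule prob_spaceI)
  have "space representing_measure = UNIV"
    using sets_eq_imp_space_eq[OF sets_representing_measure] by simp
  then show "emeasure representing_measure (space representing_measure) = 1"
    by (simp add: emeasure_representing_measure outer_open content_UNIV)
qed

text \<open>Layer cake: \<open>n * f\<close> is the sum of its truncations to the slabs \<open>[i, i + 1]\<close>, each of which is a
  test function for the open set \<open>{x. i < n * f x}\<close>.\<close>

lemma le_integral_test_function:
  assumes f: "f \<in> test_functions UNIV"
  shows "\<Lambda> f \<le> (\<integral>x. f x \<partial>representing_measure)"
proof -
  let ?M = representing_measure
  interpret prob_space ?M by (rule prob_space_representing_measure)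
  have meas: "f \<in> borel_measurable ?M"
    using bounded_continuous_borel_measurable[OF test_functionsD(2)[OF f]]
    by (simp cong: measurable_cong_sets add: sets_representing_measure)
  have "AE x in ?M. norm (f x) \<le> 1"
    using test_functionsD(3,4)[OF f] by simp
  then have int_f: "integrable ?M f"
    using meas by (rule integrable_const_bound)
  have "\<Lambda> f \<le> (\<integral>x. f x \<partial>?M) + 1 / real n" if "0 < n" for n
  proof -
    define s where "s i x = min (max 0 (real n * f x - real i)) 1" for i x
    define U where "U i = {x. real i < real n * f x}" for i
    have s_test: "s i \<in> test_functions (U i)" for i
    proof (rule test_functionsI)
      show "continuous_on UNIV (s i)"
        unfolding s_def by (intro continuous_intros test_functionsD(1)[OF f])
    qed (auto simp: s_def U_def)
    have open_U: "open (U i)" for i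
      unfolding U_def by (intro open_Collect_less continuous_intros test_functionsD(1)[OF f])
    have U_sets: "U i \<in> sets ?M" for i
      using open_U by (simp add: sets_representing_measure)
    have slabs: "(\<Sum>i<m. min (max 0 (y - real i)) 1) = min (max 0 y) (real m)" for y :: real and m
    proof (induction m)
      case (Suc m)
      then show ?case
        by (cases "y \<le> real m"; cases "y \<le> real m + 1") simp_all
    qed simp
    \<comment> \<open>Counting levels overshoots by at most 1: at most \<open>y + 1\<close> natural
      numbers lie below \<open>y\<close>. After division by \<open>n\<close> the error is
      \<open>1 / n\<close>.\<close>
    have levels: "(\<Sum>i<m. of_bool (real i < y)) \<le> min (real m) (y + 1)" if "0 \<le> y" for y :: real and m
    proof (induction m)
      case (Suc m)
      then show ?case
        by (cases "real m < y") simp_all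
    qed (use that in simp)
    have "real n * f x = (\<Sum>i<n. s i x)" for x
      using slabs[of "real n * f x" n] test_functionsD(3,4)[OF f, of x] mult_left_le[of "f x" "real n"]
      by (simp add: s_def)
    then have "real n * \<Lambda> f = \<Lambda> (\<lambda>x. \<Sum>i<n. s i x)"
      using cmult[OF test_functionsD(2)[OF f], of "real n"] by simp
    also have "\<dots> = (\<Sum>i<n. \<Lambda> (s i))"
      by (intro sum test_functionsD(2)[OF s_test])
    also have "\<dots> \<le> (\<Sum>i<n. measure ?M (U i))"
    proof (rule sum_mono)
      fix i
      have "ennreal (\<Lambda> (s i)) \<le> emeasure ?M (U i)"
        using content_upper[OF s_test] open_U by (simp add: emeasure_representing_measure outer_open)
      then show "\<Lambda> (s i) \<le> measure ?M (U i)"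
        by (simp add: emeasure_eq_measure)
    qed
    also have "\<dots> = (\<integral>x. (\<Sum>i<n. indicator (U i) x) \<partial>?M)"
      using U_sets sets.sets_into_space[OF U_sets]
      by (subst Bochner_Integration.integral_sum) (auto simp: Int_absorb2 emeasure_eq_measure)
    also have "\<dots> \<le> (\<integral>x. real n * f x + 1 \<partial>?M)"
    proof (rule integral_mono)
      show "integrable ?M (\<lambda>x. \<Sum>i<n. indicator (U i) x :: real)"
        using U_sets by (intro Bochner_Integration.integrable_sum) (auto simp: emeasure_eq_measure)
      show "integrable ?M (\<lambda>x. real n * f x + 1)"
        using int_f by simp
      show "(\<Sum>i<n. indicator (U i) x) \<le> real n * f x + 1" for x
        using levels[of "real n * f x" n] test_functionsD(3)[OF f, of x]
        by (simp add: U_def indicator_def)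
    qed
    also have "\<dots> = real n * (\<integral>x. f x \<partial>?M) + 1"
      using int_f by (simp add: prob_space)
    finally show ?thesis
      using that by (simp add: field_simps)
  qed
  then have "\<forall>\<^sub>F n in sequentially. \<Lambda> f \<le> (\<integral>x. f x \<partial>?M) + 1 / real n"
    by (rule eventually_mono[OF eventually_gt_at_top[of 0]])
  moreover have "(\<lambda>n. (\<integral>x. f x \<partial>?M) + 1 / real n) \<longlonglongrightarrow> (\<integral>x. f x \<partial>?M) + 0"
    by (intro tendsto_intros lim_1_over_n)
  ultimately show ?thesis
    using tendsto_lowerbound[of _ "(\<integral>x. f x \<partial>?M) + 0" sequentially "\<Lambda> f"] by simp
qed

text \<open>The one-sided bound applied to both \<open>g\<close> and \<open>1 - g\<close> gives
  equality, as the functional and the integral agree on constants. An affine change reduces bounded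
  \<open>f\<close> to values in [0, 1].\<close>

lemma integral_representing_measure:
  assumes f: "bounded_continuous f"
  shows "(\<integral>x. f x \<partial>representing_measure) = \<Lambda> f"
proof -
  let ?M = representing_measure
  interpret prob_space ?M by (rule prob_space_representing_measure)
  have unit: "(\<integral>x. g x \<partial>?M) = \<Lambda> g" if g: "g \<in> test_functions UNIV" for g
  proof (rule antisym)
    show "\<Lambda> g \<le> (\<integral>x. g x \<partial>?M)"
      by (rule le_integral_test_function[OF g])
    have "g \<in> borel_measurable ?M"
      using bounded_continuous_borel_measurable[OF test_functionsD(2)[OF g]]
      by (simp cong: measurable_cong_sets add: sets_representing_measure)
    then have int_g: "integrable ?M g"
      using test_functionsD(3,4)[OF g] by (intro integrable_const_bound[where B=1]) auto
    have "(\<lambda>x. 1 - g x) \<in> test_functions UNIV"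
      using test_functionsD(1,3,4)[OF g] by (intro test_functionsI continuous_intros) auto
    then have "\<Lambda> (\<lambda>x. 1 - g x) \<le> (\<integral>x. 1 - g x \<partial>?M)"
      by (rule le_integral_test_function)
    then show "(\<integral>x. g x \<partial>?M) \<le> \<Lambda> g"
      using diff[OF bounded_continuous_const test_functionsD(2)[OF g], of 1] int_g
      by (simp add: const prob_space)
  qed
  obtain B where B: "0 \<le> B" "\<And>x. \<bar>f x\<bar> \<le> B"
    using bounded_continuousE[OF f] by blast
  \<comment> \<open>The summand 1 keeps \<open>c\<close> positive when \<open>B = 0\<close>.\<close>
  define c where "c = 2 * B + 1"
  define g where "g x = (f x + B) / c" for x
  have c: "0 < c" using B by (simp add: c_def)
  have g: "g \<in> test_functions UNIV"
  proof (rule test_functionsI)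
    show "continuous_on UNIV g"
      unfolding g_def using f c by (intro continuous_intros) (auto simp: bounded_continuous_def)
    show "0 \<le> g x" for x
      using B(2)[of x] c by (simp add: g_def abs_le_iff)
    show "g x \<le> 1" for x
      using B(2)[of x] c B(1) by (simp add: g_def c_def abs_le_iff)
  qed auto
  have f_eq: "f = (\<lambda>x. c * g x - B)"
    using c by (auto simp: g_def)
  have "g \<in> borel_measurable ?M"
    using bounded_continuous_borel_measurable[OF test_functionsD(2)[OF g]]
    by (simp cong: measurable_cong_sets add: sets_representing_measure)
  then have "integrable ?M g"
    using test_functionsD(3,4)[OF g] by (intro integrable_const_bound[where B=1]) auto
  then have "(\<integral>x. c * g x - B \<partial>?M) = c * \<Lambda> g - B"
    by (simp add: prob_space unit[OF g])
  also have "\<dots> = \<Lambda> (\<lambda>x. c * g x - B)"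
    using test_functionsD(2)[OF g]
    by (simp add: diff bounded_continuous_cmult bounded_continuous_const cmult const)
  finally show ?thesis
    unfolding f_eq .
qed

end

subsection \<open>Limits of tight families\<close>

text \<open>By Tychonoff the vectors \<open>X k\<close>, which lie in a product of compact
  intervals, have a cluster point. The index type may be uncountable, where a convergent subsequence
  can fail to exist; a finer filter takes its place.\<close>

lemma cluster_filter:
  fixes X :: "nat \<Rightarrow> 'b \<Rightarrow> real"
  assumes "\<And>i. \<exists>B. \<forall>k. \<bar>X k i\<bar> \<le> B"
  obtains G where "G \<noteq> bot" "G \<le> sequentially" "\<And>i. \<exists>l. ((\<lambda>k. X k i) \<longlongrightarrow> l) G"
proof -
  obtain B where B: "\<And>k i. \<bar>X k i\<bar> \<le> B i"
    using assms by metis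
  have "compactin (product_topology (\<lambda>_. euclidean) UNIV) (\<Pi>\<^sub>E i\<in>UNIV. {- B i..B i})"
    by (subst compactin_PiE) auto
  then have "compact (\<Pi>\<^sub>E i\<in>UNIV. {- B i..B i})"
    by (simp add: euclidean_product_topology)
  moreover have "eventually (\<lambda>x. x \<in> (\<Pi>\<^sub>E i\<in>UNIV. {- B i..B i})) (filtermap X sequentially)"
    using B by (auto simp: eventually_filtermap PiE_iff abs_le_iff minus_le_iff)
  ultimately obtain x where x: "inf (nhds x) (filtermap X sequentially) \<noteq> bot"
    unfolding compact_filter by (metis filtermap_bot_iff sequentially_bot)
  \<comment> \<open>Generated by the large \<open>k\<close> for which \<open>X k\<close> is near the
    cluster point \<open>x\<close>.\<close>
  define G where "G = inf (filtercomap X (nhds x)) sequentially"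
  show thesis
  proof
    show "G \<noteq> bot"
    proof
      assume "G = bot"
      then have "eventually (\<lambda>_. False) G" by simp
      then obtain P Q where "eventually P (filtercomap X (nhds x))" "eventually Q sequentially"
        and PQ: "\<And>k. P k \<Longrightarrow> Q k \<Longrightarrow> False"
        unfolding G_def eventually_inf by blast
      then obtain R where R: "eventually R (nhds x)" "\<And>k. R (X k) \<Longrightarrow> P k"
        unfolding eventually_filtercomap by blast
      \<comment> \<open>If \<open>G\<close> were trivial, \<open>X k\<close> would avoid a
        neighbourhood of \<open>x\<close> for all large \<open>k\<close>, contradicting that
        \<open>x\<close> is a cluster point.\<close>
      have "eventually (\<lambda>y. \<not> R y) (filtermap X sequentially)"
        unfolding eventually_filtermap using \<open>eventually Q sequentially\<close>
        by eventually_elim (use PQ R(2) in blast)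
      then have "eventually (\<lambda>_. False) (inf (nhds x) (filtermap X sequentially))"
        using R(1) unfolding eventually_inf by blast
      then show False
        using x by (simp add: trivial_limit_def)
    qed
    show "G \<le> sequentially"
      by (simp add: G_def)
    show "\<exists>l. ((\<lambda>k. X k i) \<longlongrightarrow> l) G" for i
    proof
      have "filterlim X (nhds x) G"
        unfolding filterlim_iff_le_filtercomap G_def by simp
      moreover have "continuous_on UNIV (\<lambda>y :: 'b \<Rightarrow> real. y i)"
        by (rule continuous_on_product_coordinates)
      ultimately show "((\<lambda>k. X k i) \<longlongrightarrow> x i) G"
        using continuous_on_tendsto_compose[of UNIV "\<lambda>y. y i" X x G] by simp
    qed
  qed
qed

text \<open>The open sets where some \<open>f n\<close> is below \<epsilon> cover \<open>K\<close>.
  A finite subcover leaves finitely many indices, and monotonicity in \<open>n\<close> carries the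
  bound beyond the largest of them.\<close>

lemma dini_compact:
  fixes f :: "nat \<Rightarrow> 'a::topological_space \<Rightarrow> real"
  assumes K: "compact K" and f: "\<And>n. continuous_on UNIV (f n)"
    and dec: "\<And>x. decseq (\<lambda>n. f n x)" and lim: "\<And>x. (\<lambda>n. f n x) \<longlonglongrightarrow> 0" and "0 < \<epsilon>"
  obtains N where "\<And>n x. N \<le> n \<Longrightarrow> x \<in> K \<Longrightarrow> f n x < \<epsilon>"
proof -
  have "\<exists>n. f n x < \<epsilon>" for x
    using order_tendstoD(2)[OF lim \<open>0 < \<epsilon>\<close>, of x] by (auto simp: eventually_sequentially)
  moreover have "open {x. f n x < \<epsilon>}" for n
    using f by (intro open_Collect_less continuous_on_const)
  ultimately obtain I where I: "finite I" "K \<subseteq> (\<Union>n\<in>I. {x. f n x < \<epsilon>})"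
    using compactE_image[OF K, of UNIV "\<lambda>n. {x. f n x < \<epsilon>}"] by (metis (mono_tags, lifting) UN_I UNIV_I mem_Collect_eq subsetI)
  show thesis
  proof
    \<comment> \<open>Inserting 0 makes the maximum meaningful for an empty subcover.\<close>
    fix n x assume "Max (insert 0 I) \<le> n" "x \<in> K"
    then obtain m where "m \<in> I" "f m x < \<epsilon>"
      using I(2) by blast
    moreover have "m \<le> n"
      using \<open>m \<in> I\<close> \<open>Max (insert 0 I) \<le> n\<close> I(1) by simp
    ultimately show "f n x < \<epsilon>"
      using decseqD[OF dec[of x], of m n] by simp
  qed
qed

text \<open>Linearity, positivity and normalisation pass to the limit; tightness serves
  \<open>null_sequence\<close>. On a compact set of almost full mass Dini's theorem gives uniform
  smallness; off it the functions are at most 1 and the mass is small. Conditions on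
  \<open>\<nu> k\<close> hold eventually along \<open>G\<close>, since a process started at time
  \<open>-k\<close> has a law at time \<open>n\<close> only once \<open>-k \<le> n\<close>.\<close>

lemma daniell_functional_limit:
  fixes \<nu> :: "'i \<Rightarrow> 'a::metric_space measure"
  assumes "G \<noteq> bot"
    and prob: "\<forall>\<^sub>F k in G. sets (\<nu> k) = sets borel \<and> prob_space (\<nu> k)"
    and lim: "\<And>f. bounded_continuous f \<Longrightarrow> ((\<lambda>k. \<integral>x. f x \<partial>\<nu> k) \<longlongrightarrow> \<Lambda> f) G"
    and tight: "\<And>\<epsilon>::real. 0 < \<epsilon> \<Longrightarrow> \<exists>K. compact K \<and> (\<forall>\<^sub>F k in G. emeasure (\<nu> k) (UNIV - K) < ennreal \<epsilon>)"
  shows "daniell_functional \<Lambda>"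
proof
  note unique = tendsto_unique[OF \<open>G \<noteq> bot\<close>]
  have integrable: "integrable M f"
    if M: "sets M = sets borel" "prob_space M" and f: "bounded_continuous f" for M :: "'a measure" and f
  proof -
    interpret prob_space M by fact
    obtain B where "\<And>x. \<bar>f x\<bar> \<le> B"
      using bounded_continuousE[OF f] by blast
    moreover have "f \<in> borel_measurable M"
      using bounded_continuous_borel_measurable[OF f] by (simp cong: measurable_cong_sets add: M(1))
    ultimately show ?thesis
      by (intro integrable_const_bound[where B=B]) auto
  qed
  show "\<Lambda> (\<lambda>x. f x + g x) = \<Lambda> f + \<Lambda> g" if f: "bounded_continuous f" and g: "bounded_continuous g" for f g
  proof (rule unique)
    show "((\<lambda>k. \<integral>x. f x + g x \<partial>\<nu> k) \<longlongrightarrow> \<Lambda> (\<lambda>x. f x + g x)) G"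
      by (intro lim bounded_continuous_add f g)
    have "\<forall>\<^sub>F k in G. (\<integral>x. f x \<partial>\<nu> k) + (\<integral>x. g x \<partial>\<nu> k) = (\<integral>x. f x + g x \<partial>\<nu> k)"
      using prob by eventually_elim (use integrable f g in simp)
    then show "((\<lambda>k. \<integral>x. f x + g x \<partial>\<nu> k) \<longlongrightarrow> \<Lambda> f + \<Lambda> g) G"
      by (rule Lim_transform_eventually[OF tendsto_add[OF lim[OF f] lim[OF g]]])
  qed
  show "\<Lambda> (\<lambda>x. c * f x) = c * \<Lambda> f" if f: "bounded_continuous f" for c f
  proof (rule unique)
    show "((\<lambda>k. \<integral>x. c * f x \<partial>\<nu> k) \<longlongrightarrow> \<Lambda> (\<lambda>x. c * f x)) G"
      by (intro lim bounded_continuous_cmult f)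
    show "((\<lambda>k. \<integral>x. c * f x \<partial>\<nu> k) \<longlongrightarrow> c * \<Lambda> f) G"
      using tendsto_mult_left[OF lim[OF f], of c] by simp
  qed
  show nonneg: "0 \<le> \<Lambda> f" if f: "bounded_continuous f" and "\<And>x. 0 \<le> f x" for f
    using lim[OF f] \<open>G \<noteq> bot\<close> that(2) by (intro tendsto_lowerbound[OF lim[OF f]]) auto
  show "\<Lambda> (\<lambda>_. 1) = 1"
  proof (rule unique)
    show "((\<lambda>k. \<integral>x. 1 \<partial>\<nu> k) \<longlongrightarrow> \<Lambda> (\<lambda>_. 1)) G"
      by (intro lim bounded_continuous_const)
    have "\<forall>\<^sub>F k in G. (\<integral>x. 1 \<partial>\<nu> k) = (1::real)"
      using prob by eventually_elim (simp add: prob_space.prob_space)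
    then show "((\<lambda>k. \<integral>x. 1 \<partial>\<nu> k) \<longlongrightarrow> (1::real)) G"
      by (rule tendsto_eventually)
  qed
  fix d :: "nat \<Rightarrow> 'a \<Rightarrow> real"
  assume cont: "\<And>n. continuous_on UNIV (d n)" and bounds: "\<And>n x. 0 \<le> d n x \<and> d n x \<le> 1"
    and dec: "\<And>x. decseq (\<lambda>n. d n x)" and null: "\<And>x. (\<lambda>n. d n x) \<longlonglongrightarrow> 0"
  have bc: "bounded_continuous (d n)" for n
    using bounds by (intro bounded_continuousI[where B=1] cont) simp
  show "(\<lambda>n. \<Lambda> (d n)) \<longlonglongrightarrow> 0"
  proof (rule LIMSEQ_I)
    fix r :: real assume "0 < r"
    \<comment> \<open>The bound reached is \<open>2 * \<epsilon>\<close>, one \<epsilon> on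
      \<open>K\<close> and one off it; a third of \<open>r\<close> keeps it strictly below
      \<open>r\<close>.\<close>
    define \<epsilon> where "\<epsilon> = r / 3"
    have "0 < \<epsilon>" using \<open>0 < r\<close> by (simp add: \<epsilon>_def)
    obtain K where K: "compact K" "\<forall>\<^sub>F k in G. emeasure (\<nu> k) (UNIV - K) < ennreal \<epsilon>"
      using tight[OF \<open>0 < \<epsilon>\<close>] by blast
    have K_sets: "UNIV - K \<in> sets borel"
      using compact_imp_closed[OF K(1)] by auto
    obtain N where N: "\<And>n x. N \<le> n \<Longrightarrow> x \<in> K \<Longrightarrow> d n x < \<epsilon>"
      using dini_compact[OF K(1) cont dec null \<open>0 < \<epsilon>\<close>] by blast
    \<comment> \<open>\<open>N\<close> depends on \<open>K\<close> but not on \<open>k\<close>, so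
      for fixed \<open>n\<close> the bound on the integrals survives the limit along
      \<open>G\<close>.\<close>
    have "\<Lambda> (d n) \<le> 2 * \<epsilon>" if "N \<le> n" for n
    proof (rule tendsto_upperbound[OF lim[OF bc] _ \<open>G \<noteq> bot\<close>])
      show "\<forall>\<^sub>F k in G. (\<integral>x. d n x \<partial>\<nu> k) \<le> 2 * \<epsilon>"
        using prob K(2)
      proof eventually_elim
        fix k assume \<nu>: "sets (\<nu> k) = sets borel \<and> prob_space (\<nu> k)"
          and small: "emeasure (\<nu> k) (UNIV - K) < ennreal \<epsilon>"
        interpret prob_space "\<nu> k" using \<nu> by simp
        have KC: "UNIV - K \<in> sets (\<nu> k)"
          using K_sets \<nu> by simp
        have "(\<integral>x. d n x \<partial>\<nu> k) \<le> (\<integral>x. \<epsilon> + indicator (UNIV - K) x \<partial>\<nu> k)"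
        proof (rule integral_mono)
          show "integrable (\<nu> k) (d n)"
            using \<nu> bc integrable by blast
          show "integrable (\<nu> k) (\<lambda>x. \<epsilon> + indicator (UNIV - K) x)"
            using KC by (simp add: emeasure_eq_measure)
          show "d n x \<le> \<epsilon> + indicator (UNIV - K) x" for x
            using N[OF that, of x] bounds[of n x] \<open>0 < \<epsilon>\<close> by (cases "x \<in> K") auto
        qed
        also have "\<dots> = \<epsilon> + measure (\<nu> k) (UNIV - K)"
          using KC sets.sets_into_space[OF KC] by (simp add: emeasure_eq_measure prob_space Int_absorb2)
        also have "\<dots> \<le> 2 * \<epsilon>"
          using small by (simp add: emeasure_eq_measure ennreal_less_iff)
        finally show "(\<integral>x. d n x \<partial>\<nu> k) \<le> 2 * \<epsilon>" .
      qed
    qed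
    then have "norm (\<Lambda> (d n) - 0) < r" if "N \<le> n" for n
      using that nonneg[OF bc] bounds \<open>0 < r\<close> by (force simp: \<epsilon>_def)
    then show "\<exists>N. \<forall>n\<ge>N. norm (\<Lambda> (d n) - 0) < r"
      by blast
  qed
qed

subsection \<open>Transition operators\<close>

lemma (in transition_probabilities) transition_op_prob_space:
  assumes "\<tau> \<le> t" "sets \<nu> = sets borel" "prob_space \<nu>"
  shows "sets (transition_op P \<tau> t \<nu>) = sets borel" "prob_space (transition_op P \<tau> t \<nu>)"
  using transition_op_in_prob_algebra[OF assms] by (auto simp: space_prob_algebra)

text \<open>Chapman-Kolmogorov integrated over the initial law; \<open>nn_integral_bind\<close>
  turns the integral against the intermediate law into an iterated one.\<close>

lemma (in transition_probabilities) transition_op_compose: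
  assumes "s \<le> \<tau>" "\<tau> \<le> t" and \<nu>: "sets \<nu> = sets borel" "prob_space \<nu>"
  shows "transition_op P \<tau> t (transition_op P s \<tau> \<nu>) = transition_op P s t \<nu>"
proof (rule measure_eqI)
  note 1 = transition_op_prob_space[OF assms(1) \<nu>]
  have st: "s \<le> t" using assms by simp
  show sets_eq: "sets (transition_op P \<tau> t (transition_op P s \<tau> \<nu>)) = sets (transition_op P s t \<nu>)"
    using transition_op_prob_space[OF assms(2) 1] transition_op_prob_space[OF st \<nu>] by simp
  fix A assume "A \<in> sets (transition_op P \<tau> t (transition_op P s \<tau> \<nu>))"
  then have A: "A \<in> sets borel"
    using transition_op_prob_space[OF assms(2) 1] by simp
  have kernel: "(\<lambda>x. P s x \<tau>) \<in> \<nu> \<rightarrow>\<^sub>M subprob_algebra borel"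
    using measurable_prob_algebraD[OF measurable_kernel[OF assms(1)]]
    by (simp cong: measurable_cong_sets add: \<nu>(1))
  have "emeasure (transition_op P \<tau> t (transition_op P s \<tau> \<nu>)) A
      = (\<integral>\<^sup>+ y. emeasure (P \<tau> y t) A \<partial>transition_op P s \<tau> \<nu>)"
    by (rule emeasure_transition_op[OF assms(2) 1 A])
  also have "\<dots> = (\<integral>\<^sup>+ x. \<integral>\<^sup>+ y. emeasure (P \<tau> y t) A \<partial>P s x \<tau> \<partial>\<nu>)"
    unfolding transition_op_def by (rule nn_integral_bind[OF measurable_P[OF assms(2) A] kernel])
  also have "\<dots> = (\<integral>\<^sup>+ x. emeasure (P s x t) A \<partial>\<nu>)"
    using chapman_kolmogorov[OF assms(1,2) A] by simp
  also have "\<dots> = emeasure (transition_op P s t \<nu>) A"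
    using emeasure_transition_op[OF st \<nu> A] by simp
  finally show "emeasure (transition_op P \<tau> t (transition_op P s \<tau> \<nu>)) A = emeasure (transition_op P s t \<nu>) A" .
qed

text \<open>Duality between the operators on measures and on functions; through it the Feller
  property, which concerns functions, acts on laws.\<close>

lemma (in transition_probabilities) integral_transition_op:
  assumes "\<tau> \<le> t" and \<nu>: "sets \<nu> = sets borel" "prob_space \<nu>" and f: "bounded_continuous f"
  shows "(\<integral>x. f x \<partial>transition_op P \<tau> t \<nu>) = (\<integral>x. transition_semigroup P \<tau> t f x \<partial>\<nu>)"
proof -
  interpret \<nu>: prob_space \<nu> by fact
  obtain B where "\<And>x. \<bar>f x\<bar> \<le> B"
    using bounded_continuousE[OF f] by blast
  moreover have "(\<lambda>x. P \<tau> x t) \<in> \<nu> \<rightarrow>\<^sub>M subprob_algebra borel"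
    using measurable_prob_algebraD[OF measurable_kernel[OF assms(1)]]
    by (simp cong: measurable_cong_sets add: \<nu>(1))
  moreover have "AE x in \<nu>. emeasure (P \<tau> x t) (space (P \<tau> x t)) \<le> ennreal 1"
    using prob_space.emeasure_space_1[OF prob_space_P[OF assms(1)]] by simp
  ultimately show ?thesis
    unfolding transition_op_def transition_semigroup_def
    using bounded_continuous_borel_measurable[OF f] \<nu>.finite_measure_axioms
    by (intro integral_bind[where K=borel and B'=1]) auto
qed

text \<open>The way from \<open>\<lfloor>s\<rfloor>\<close> to \<open>t\<close> may pass through
  \<open>s\<close> or through \<open>\<lfloor>t\<rfloor>\<close>, with the same result by
  Chapman-Kolmogorov. The first route transports the member at \<open>s\<close>; the second yields
  the member at \<open>t\<close> by invariance at integer times.\<close>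

lemma (in transition_probabilities) invariant_measure_family_from_integer_times:
  fixes m :: "int \<Rightarrow> 'a measure"
  assumes m: "\<And>n. sets (m n) = sets borel" "\<And>n. prob_space (m n)"
    and inv: "\<And>n k. transition_op P (of_int n) (of_int n + of_nat k) (m n) = m (n + int k)"
  shows "invariant_measure_family P (\<lambda>t. transition_op P (of_int \<lfloor>t\<rfloor>) t (m \<lfloor>t\<rfloor>))"
  unfolding invariant_measure_family_def
proof (intro conjI allI impI)
  show "sets (transition_op P (of_int \<lfloor>t\<rfloor>) t (m \<lfloor>t\<rfloor>)) = sets borel"
    and "prob_space (transition_op P (of_int \<lfloor>t\<rfloor>) t (m \<lfloor>t\<rfloor>))" for t
    using transition_op_prob_space[OF of_int_floor_le m] by auto
  fix s t :: real assume "s \<le> t"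
  define k where "k = nat (\<lfloor>t\<rfloor> - \<lfloor>s\<rfloor>)"
  have k: "\<lfloor>t\<rfloor> = \<lfloor>s\<rfloor> + int k" "real_of_int \<lfloor>t\<rfloor> = of_int \<lfloor>s\<rfloor> + of_nat k"
    using floor_mono[OF \<open>s \<le> t\<close>] by (auto simp: k_def)
  have "transition_op P s t (transition_op P (of_int \<lfloor>s\<rfloor>) s (m \<lfloor>s\<rfloor>)) = transition_op P (of_int \<lfloor>s\<rfloor>) t (m \<lfloor>s\<rfloor>)"
    using \<open>s \<le> t\<close> m by (intro transition_op_compose) auto
  also have "\<dots> = transition_op P (of_int \<lfloor>t\<rfloor>) t (transition_op P (of_int \<lfloor>s\<rfloor>) (of_int \<lfloor>t\<rfloor>) (m \<lfloor>s\<rfloor>))"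
    using m floor_mono[OF \<open>s \<le> t\<close>] by (intro transition_op_compose[symmetric]) auto
  also have "transition_op P (of_int \<lfloor>s\<rfloor>) (of_int \<lfloor>t\<rfloor>) (m \<lfloor>s\<rfloor>) = m \<lfloor>t\<rfloor>"
    using inv[of "\<lfloor>s\<rfloor>" k] unfolding k(2) unfolding k(1) .
  finally show "transition_op P s t (transition_op P (of_int \<lfloor>s\<rfloor>) s (m \<lfloor>s\<rfloor>)) =
      transition_op P (of_int \<lfloor>t\<rfloor>) t (m \<lfloor>t\<rfloor>)" .
qed

section \<open>Existence of the invariant family\<close>

theorem theorem3p2:
  fixes P :: "real \<Rightarrow> 'a::polish_space \<Rightarrow> real \<Rightarrow> 'a measure"
  assumes "transition_probabilities P"
    and "feller_integer_times P"
    and "\<exists>\<mu>::'a measure. sets \<mu> = sets borel \<and> prob_space \<mu> \<and>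
      (\<forall>n::int. tight_measures
        {transition_op P (of_int n - of_nat s) (of_int n) \<mu> |s::nat. s \<ge> 1})"
  shows "\<exists>\<mu>. invariant_measure_family P \<mu>"
proof -
  interpret transition_probabilities P by fact
  obtain \<mu> :: "'a measure" where \<mu>: "sets \<mu> = sets borel" "prob_space \<mu>"
    and tight: "\<And>n::int. tight_measures {transition_op P (of_int n - of_nat s) (of_int n) \<mu> |s::nat. s \<ge> 1}"
    using assms(3) by blast
  \<comment> \<open>The starting time \<open>-k\<close> is common to all \<open>n\<close>, so
    transition operators carry \<open>\<nu> n k\<close> to a later \<open>\<nu>\<close> with the
    same \<open>k\<close>, and one filter serves all times. Starting at \<open>n - s\<close> would
    shift the index.\<close>
  define \<nu> where "\<nu> n k = transition_op P (- real k) (real_of_int n) \<mu>" for n :: int and k :: nat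
  have \<nu>: "sets (\<nu> n k) = sets borel" "prob_space (\<nu> n k)" if "- int k \<le> n" for n k
  proof -
    have "- real k \<le> real_of_int n"
      using that by linarith
    then show "sets (\<nu> n k) = sets borel" "prob_space (\<nu> n k)"
      unfolding \<nu>_def using transition_op_prob_space[OF _ \<mu>] by auto
  qed
  \<comment> \<open>The default 0, for times before the start and for functions outside the class,
    keeps every coordinate bounded as \<open>cluster_filter\<close> demands.\<close>
  define X where "X k = (\<lambda>(n, f). if - int k \<le> n \<and> bounded_continuous f then \<integral>x. f x \<partial>\<nu> n k else 0)"
    for k :: nat
  have "\<exists>B. \<forall>k. \<bar>X k i\<bar> \<le> B" for i
  proof (cases "bounded_continuous (snd i)")
    case True
    then obtain B where B: "0 \<le> B" "\<And>x. \<bar>snd i x\<bar> \<le> B"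
      using bounded_continuousE by blast
    have "\<bar>\<integral>x. snd i x \<partial>\<nu> (fst i) k\<bar> \<le> B" if "- int k \<le> fst i" for k
    proof -
      interpret prob_space "\<nu> (fst i) k" using \<nu>(2)[OF that] .
      have "snd i \<in> borel_measurable (\<nu> (fst i) k)"
        using bounded_continuous_borel_measurable[OF True]
        by (simp cong: measurable_cong_sets add: \<nu>(1)[OF that])
      then have "integrable (\<nu> (fst i) k) (snd i)"
        using B by (intro integrable_const_bound[where B=B]) auto
      then have "\<bar>\<integral>x. snd i x \<partial>\<nu> (fst i) k\<bar> \<le> (\<integral>x. B \<partial>\<nu> (fst i) k)"
        using B by (intro order_trans[OF integral_abs_bound] integral_mono) auto
      then show ?thesis
        by (simp add: prob_space)
    qed
    then show ?thesis
      using B(1) by (intro exI[of _ B]) (auto simp: X_def split: prod.split)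
  qed (auto simp: X_def split: prod.split)
  then obtain G where G: "G \<noteq> bot" "G \<le> sequentially"
    and "\<And>i. \<exists>l. ((\<lambda>k. X k i) \<longlongrightarrow> l) G"
    using cluster_filter[of X] by blast
  then obtain l where l: "\<And>i. ((\<lambda>k. X k i) \<longlongrightarrow> l i) G"
    by metis
  define \<Lambda> where "\<Lambda> n f = l (n, f)" for n f
  \<comment> \<open>The bound is 1 and not 0 because the elapsed time \<open>n + k\<close> plays the
    role of \<open>s\<close> in the tight families, which have \<open>s \<ge> 1\<close>.\<close>
  have large: "\<forall>\<^sub>F k in G. 1 \<le> n + int k" for n :: int
  proof -
    have "\<forall>\<^sub>F k in sequentially. 1 \<le> n + int k"
      by (rule eventually_mono[OF eventually_ge_at_top[of "nat (1 - n)"]]) linarith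
    then show ?thesis
      using G(2) by (simp add: le_filter_def)
  qed
  have lim: "((\<lambda>k. \<integral>x. f x \<partial>\<nu> n k) \<longlongrightarrow> \<Lambda> n f) G" if "bounded_continuous f" for n f
  proof (rule Lim_transform_eventually)
    show "((\<lambda>k. X k (n, f)) \<longlongrightarrow> \<Lambda> n f) G"
      unfolding \<Lambda>_def by (rule l)
    show "\<forall>\<^sub>F k in G. X k (n, f) = (\<integral>x. f x \<partial>\<nu> n k)"
      using large[of n] by eventually_elim (simp add: X_def that)
  qed
  have functional: "daniell_functional (\<Lambda> n)" for n
  proof (rule daniell_functional_limit[OF G(1) _ lim])
    show "\<forall>\<^sub>F k in G. sets (\<nu> n k) = sets borel \<and> prob_space (\<nu> n k)"
      using large[of n] by eventually_elim (simp add: \<nu>)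
    fix \<epsilon> :: real assume "0 < \<epsilon>"
    then have "\<exists>K. compact K \<and> (\<forall>\<rho>\<in>{transition_op P (of_int n - of_nat s) (of_int n) \<mu> |s::nat. s \<ge> 1}.
        emeasure \<rho> (UNIV - K) < ennreal \<epsilon>)"
      using tight[of n] unfolding tight_measures_def by (elim allE impE)
    then obtain K where K: "compact K" "\<forall>\<rho>\<in>{transition_op P (of_int n - of_nat s) (of_int n) \<mu> |s::nat. s \<ge> 1}.
        emeasure \<rho> (UNIV - K) < ennreal \<epsilon>"
      by (elim exE conjE)
    have "emeasure (\<nu> n k) (UNIV - K) < ennreal \<epsilon>" if "1 \<le> n + int k" for k
    proof -
      have "- real k = real_of_int n - real (nat (n + int k))"
        using that by simp
      moreover have "1 \<le> nat (n + int k)"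
        using that by linarith
      ultimately have "\<nu> n k \<in> {transition_op P (of_int n - of_nat s) (of_int n) \<mu> |s::nat. s \<ge> 1}"
        unfolding \<nu>_def by (intro CollectI exI[of _ "nat (n + int k)"] conjI) simp_all
      then show ?thesis
        by (rule bspec[OF K(2)])
    qed
    then have "\<forall>\<^sub>F k in G. emeasure (\<nu> n k) (UNIV - K) < ennreal \<epsilon>"
      by (rule eventually_mono[OF large[of n]])
    then show "\<exists>K. compact K \<and> (\<forall>\<^sub>F k in G. emeasure (\<nu> n k) (UNIV - K) < ennreal \<epsilon>)"
      using K(1) by (intro exI[of _ K] conjI)
  qed
  define m where "m n = daniell_functional.representing_measure (\<Lambda> n)" for n
  have m: "sets (m n) = sets borel" "prob_space (m n)" for n
    unfolding m_def using daniell_functional.sets_representing_measure[OF functional]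
      daniell_functional.prob_space_representing_measure[OF functional] by auto
  have integral_m: "(\<integral>x. f x \<partial>m n) = \<Lambda> n f" if "bounded_continuous f" for n f
    unfolding m_def by (rule daniell_functional.integral_representing_measure[OF functional that])
  have "transition_op P (of_int n) (of_int n + of_nat k) (m n) = m (n + int k)" for n k
  proof (rule finite_borel_measure_eqI_bounded_continuous)
    let ?Q = "transition_op P (of_int n) (of_int n + of_nat k)"
    let ?T = "transition_semigroup P (of_int n) (of_int n + of_nat k)"
    have step: "real_of_int n \<le> of_int n + of_nat k" by simp
    show "sets (?Q (m n)) = sets borel" "finite_measure (?Q (m n))"
      using transition_op_prob_space[OF step m] by (auto intro: prob_space.finite_measure)
    show "sets (m (n + int k)) = sets borel" "finite_measure (m (n + int k))"
      using m by (auto intro: prob_space.finite_measure)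
    fix f :: "'a \<Rightarrow> real" assume f: "bounded_continuous f"
    \<comment> \<open>The Feller property makes \<open>?T f\<close> an admissible test function, so
      its integrals converge along \<open>G\<close> as well.\<close>
    then have Tf: "bounded_continuous (?T f)"
      using assms(2) unfolding feller_integer_times_def bounded_continuous_def by blast
    \<comment> \<open>Once the process has started, its law at \<open>n + k\<close> is the
      transported law at \<open>n\<close>, so both integrals agree; comparing their limits along
      \<open>G\<close> gives invariance on test functions.\<close>
    have "\<forall>\<^sub>F j in G. (\<integral>x. ?T f x \<partial>\<nu> n j) = (\<integral>x. f x \<partial>\<nu> (n + int k) j)"
      using large[of n]
    proof eventually_elim
      fix j assume j: "1 \<le> n + int j"
      then have le: "- int j \<le> n" and "- real j \<le> real_of_int n" by linarith+
      then have "?Q (\<nu> n j) = \<nu> (n + int k) j"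
        unfolding \<nu>_def using transition_op_compose[OF _ step \<mu>] by simp
      then show "(\<integral>x. ?T f x \<partial>\<nu> n j) = (\<integral>x. f x \<partial>\<nu> (n + int k) j)"
        using integral_transition_op[OF step \<nu>[OF le] f] by simp
    qed
    then have "((\<lambda>j. \<integral>x. f x \<partial>\<nu> (n + int k) j) \<longlongrightarrow> \<Lambda> n (?T f)) G"
      by (rule Lim_transform_eventually[OF lim[OF Tf]])
    then have "\<Lambda> n (?T f) = \<Lambda> (n + int k) f"
      using lim[OF f] tendsto_unique[OF G(1)] by blast
    then show "(\<integral>x. f x \<partial>?Q (m n)) = (\<integral>x. f x \<partial>m (n + int k))"
      using integral_transition_op[OF step m f] integral_m[OF f] integral_m[OF Tf] by simp
  qed
  then have "invariant_measure_family P (\<lambda>t. transition_op P (of_int \<lfloor>t\<rfloor>) t (m \<lfloor>t\<rfloor>))"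
    by (intro invariant_measure_family_from_integer_times m)
  then show ?thesis by blast
qed

end
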